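(* There exist pairs of single-qubit incoherent states $\rho_B=\mathrm{diag}(\lambda,1-\lambda)$ and $\sigma_B=\mathrm{diag}(\mu,1-\mu)$, with $\lambda,\mu\in(0,1)$, whose purifications onto $AB$ are two-qubit pure entangled states, for which $$P_{\mathrm{error}}^{\mathrm{NPOVM}}(\rho_B,\sigma_B;d,E)\;<\;P_{\mathrm{error}}^{\mathrm{POVM}}(\rho_B,\sigma_B),$$ where $d$ and $E$ are the bounds on, respectively, the distinguishability of the auxiliary states and the entanglement of the extensions, as defined in the context. Moreover, this advantage persists even when the auxiliary states are arbitrarily close, i.e. for arbitrarily small $d>0$.
   Context: A state on $\mathbb{C}^n$ is a positive semidefinite $n\times n$ complex matrix of trace one. The trace norm is $\|X\|_1=\mathrm{Tr}\sqrt{X^\dagger X}$. Let $\mathcal{H}_A=\mathcal{H}_B=\mathbb{C}^2$, where $A$ is the auxiliary qubit and $B$ the system qubit. A single-qubit state is incoherent if it is diagonal in the computational basis $\{\ket0,\ket1\}$. One of $\rho_B,\sigma_B$, chosen with equal prior probabilities, is prepared by Alice and sent to Bob, who has to identify it. The minimum error probability with positive operator-valued measurements (the Helstrom bound) is $$P_{\mathrm{error}}^{\mathrm{POVM}}(\rho_B,\sigma_B)=\tfrac12-\tfrac14\|\rho_B-\sigma_B\|_1 .$$ The error probability with non-positive operator-valued measurements (NPOVMs) is defined through pure extensions. For angles $\theta,\phi\in[0,\pi/2]$ let $\ket{\psi_A}=\cos\theta\ket0+\sin\theta\ket1$, $\ket{\psi_A^\perp}=\sin\theta\ket0-\cos\theta\ket1$,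 $\ket{\phi_A}=\cos\phi\ket0+\sin\phi\ket1$, $\ket{\phi_A^\perp}=\sin\phi\ket0-\cos\phi\ket1$, and $$\ket{\Psi_{AB}}=\sqrt{\lambda}\,\ket{\psi_A}\otimes\ket0_B+\sqrt{1-\lambda}\,\ket{\psi_A^\perp}\otimes\ket1_B,$$ $$\ket{\Phi_{AB}}=\sqrt{\mu}\,\ket{\phi_A}\otimes\ket0_B+\sqrt{1-\mu}\,\ket{\phi_A^\perp}\otimes\ket1_B .$$ Put $\rho_{AB}=\ket{\Psi_{AB}}\bra{\Psi_{AB}}$ and $\sigma_{AB}=\ket{\Phi_{AB}}\bra{\Phi_{AB}}$; these have $B$-marginals $\rho_B=\mathrm{diag}(\lambda,1-\lambda)$ and $\sigma_B=\mathrm{diag}(\mu,1-\mu)$. The auxiliary states are the $A$-marginals $\rho_A=\mathrm{Tr}_B(\rho_{AB})$ and $\sigma_A=\mathrm{Tr}_B(\sigma_{AB})$. Entanglement is measured by the concurrence $C(\ket\psi)=|\braket{\psi|\tilde\psi}|$, $\ket{\tilde\psi}=(\sigma_y\otimes\sigma_y)\ket{\psi}^*$ (with $\sigma_y$ the Pauli-$y$ matrix and $*$ complex conjugation in the computational basis), which gives $C(\ket{\Psi_{AB}})=2\sqrt{\lambda(1-\lambda)}$ and $C(\ket{\Phi_{AB}})=2\sqrt{\mu(1-\mu)}$. For real bounds $d$ and $E$, with $0<d<1$, $$P_{\mathrm{error}}^{\mathrm{NPOVM}}(\rho_B,\sigma_B;d,E)=\min\left(\tfrac12-\tfrac14\|\rho_{AB}-\sigma_{AB}\|_1\right),$$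 the minimum being over $\theta,\phi$ subject to $\|\rho_A-\sigma_A\|_1\le d$ and $\max\{2\sqrt{\lambda(1-\lambda)},\,2\sqrt{\mu(1-\mu)}\}\le E$. *)

theory Defs
  imports "HOL-Analysis.Analysis"
begin

text \<open>Matrices over an arbitrary finite index type. The elements of the index type \<^typ>\<open>2\<close> are
  \<open>0\<close> and \<open>1\<close>, which label the computational basis; a two-qubit system is indexed by
  \<^typ>\<open>2 \<times> 2\<close>, with the \<open>A\<close>-label first and the \<open>B\<close>-label second.\<close>

definition braket :: "complex^'n::finite \<Rightarrow> complex^'n \<Rightarrow> complex" where
  "braket u v = (\<Sum>i\<in>UNIV. cnj (u $ i) * v $ i)"

definition proj :: "complex^'n::finite \<Rightarrow> complex^'n^'n" where
  "proj v = (\<chi> i j. v $ i * cnj (v $ j))"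

definition dagger :: "complex^'n^'m \<Rightarrow> complex^'m^'n" where
  "dagger X = (\<chi> i j. cnj (X $ j $ i))"

text \<open>Over the complex numbers, a matrix whose quadratic form is real is Hermitian.\<close>

definition psd :: "complex^'n^'n::finite \<Rightarrow> bool" where
  "psd X \<longleftrightarrow> (\<forall>v. braket v (X *v v) \<in> \<real> \<and> 0 \<le> Re (braket v (X *v v)))"

definition state :: "complex^'n^'n::finite \<Rightarrow> bool" where
  "state \<rho> \<longleftrightarrow> psd \<rho> \<and> trace \<rho> = 1"

text \<open>The positive semidefinite square root, which exists and is unique for positive semidefinite
  arguments; it is only used on matrices of the form \<open>X\<^sup>\<dagger>X\<close>.\<close>

definition psd_sqrt :: "complex^'n^'n::finite \<Rightarrow> complex^'n^'n" where
  "psd_sqrt X = (THE S. psd S \<and> S ** S = X)"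

definition trace_norm :: "complex^'n^'n::finite \<Rightarrow> real" where
  "trace_norm X = Re (trace (psd_sqrt (dagger X ** X)))"

definition tensor_vec :: "complex^'m::finite \<Rightarrow> complex^'n::finite \<Rightarrow> complex^('m \<times> 'n)" where
  "tensor_vec u v = (\<chi> p. u $ fst p * v $ snd p)"

definition tensor_mat ::
  "complex^'m^'m::finite \<Rightarrow> complex^'n^'n::finite \<Rightarrow> complex^('m \<times> 'n)^('m \<times> 'n)" where
  "tensor_mat X Y = (\<chi> p q. X $ fst p $ fst q * Y $ snd p $ snd q)"

definition ptrace_A :: "complex^('m \<times> 'n)^('m::finite \<times> 'n::finite) \<Rightarrow> complex^'n^'n" where
  "ptrace_A X = (\<chi> j j'. \<Sum>i\<in>UNIV. X $ (i, j) $ (i, j'))"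

definition ptrace_B :: "complex^('m \<times> 'n)^('m::finite \<times> 'n::finite) \<Rightarrow> complex^'m^'m" where
  "ptrace_B X = (\<chi> i i'. \<Sum>j\<in>UNIV. X $ (i, j) $ (i', j))"

definition purification_on_AB :: "complex^(2 \<times> 2) \<Rightarrow> complex^2^2 \<Rightarrow> bool" where
  "purification_on_AB x \<rho> \<longleftrightarrow> braket x x = 1 \<and> ptrace_A (proj x) = \<rho>"

definition entangled :: "complex^(2 \<times> 2) \<Rightarrow> bool" where
  "entangled x \<longleftrightarrow> \<not> (\<exists>u v. x = tensor_vec u v)"

definition pauli_y :: "complex^2^2" where
  "pauli_y = (\<chi> i j. if i = 0 \<and> j = 1 then - \<i> else if i = 1 \<and> j = 0 then \<i> else 0)"

definition concurrence :: "complex^(2 \<times> 2) \<Rightarrow> real" where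
  "concurrence x = cmod (braket x (tensor_mat pauli_y pauli_y *v (\<chi> p. cnj (x $ p))))"

definition incoherent :: "complex^2^2 \<Rightarrow> bool" where
  "incoherent \<rho> \<longleftrightarrow> state \<rho> \<and> (\<forall>i j. i \<noteq> j \<longrightarrow> \<rho> $ i $ j = 0)"

definition diag_qubit :: "real \<Rightarrow> complex^2^2" where
  "diag_qubit l = (\<chi> i j. if i = j then (if i = 0 then of_real l else of_real (1 - l)) else 0)"

definition povm_error :: "complex^2^2 \<Rightarrow> complex^2^2 \<Rightarrow> real" where
  "povm_error \<rho> \<sigma> = 1/2 - 1/4 * trace_norm (\<rho> - \<sigma>)"

definition ket :: "2 \<Rightarrow> complex^2" where
  "ket i = axis i 1"

definition aux :: "real \<Rightarrow> complex^2" where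
  "aux \<theta> = cos \<theta> *\<^sub>R ket 0 + sin \<theta> *\<^sub>R ket 1"

definition aux_perp :: "real \<Rightarrow> complex^2" where
  "aux_perp \<theta> = sin \<theta> *\<^sub>R ket 0 - cos \<theta> *\<^sub>R ket 1"

definition extension :: "real \<Rightarrow> real \<Rightarrow> complex^(2 \<times> 2)" where
  "extension l \<theta> =
     sqrt l *\<^sub>R tensor_vec (aux \<theta>) (ket 0) + sqrt (1 - l) *\<^sub>R tensor_vec (aux_perp \<theta>) (ket 1)"

definition npovm_feasible :: "real \<Rightarrow> real \<Rightarrow> real \<Rightarrow> real \<Rightarrow> (real \<times> real) set" where
  "npovm_feasible l m d E =
     {(\<theta>, \<phi>). \<theta> \<in> {0..pi/2} \<and> \<phi> \<in> {0..pi/2} \<and>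
        trace_norm (ptrace_B (proj (extension l \<theta>)) - ptrace_B (proj (extension m \<phi>))) \<le> d \<and>
        max (concurrence (extension l \<theta>)) (concurrence (extension m \<phi>)) \<le> E}"

definition npovm_errors :: "real \<Rightarrow> real \<Rightarrow> real \<Rightarrow> real \<Rightarrow> real set" where
  "npovm_errors l m d E =
     (\<lambda>(\<theta>, \<phi>). 1/2 - 1/4 * trace_norm (proj (extension l \<theta>) - proj (extension m \<phi>)))
       ` npovm_feasible l m d E"

text \<open>The least achievable error. This is meaningful only if \<^const>\<open>npovm_errors\<close> has a least
  element, in which case the infimum belongs to the set.\<close>

definition npovm_error :: "real \<Rightarrow> real \<Rightarrow> real \<Rightarrow> real \<Rightarrow> real" where
  "npovm_error l m d E = Inf (npovm_errors l m d E)"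

lemma two_neq: "(0::2) \<noteq> 1" "(1::2) \<noteq> 0"
  by simp_all

lemma UNIV_two: "(UNIV :: 2 set) = {0, 1}"
proof -
  have "x = 0 \<or> x = 1" for x :: 2
    using exhaust_2[of x] by auto
  then show ?thesis by auto
qed

lemma sum_two: "(\<Sum>i\<in>(UNIV :: 2 set). f i) = f 0 + (f 1 :: 'a::comm_monoid_add)"
  by (simp add: UNIV_two)

lemma sum_two_two:
  "(\<Sum>p\<in>(UNIV :: (2 \<times> 2) set). f p) =
     f (0, 0) + f (0, 1) + (f (1, 0) + (f (1, 1) :: 'a::comm_monoid_add))"
proof -
  have "(\<Sum>p\<in>(UNIV :: (2 \<times> 2) set). f p) = (\<Sum>i\<in>(UNIV :: 2 set). \<Sum>j\<in>(UNIV :: 2 set). f (i, j))"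
    by (simp add: sum.cartesian_product)
  then show ?thesis by (simp add: sum_two)
qed

lemma all_two: "(\<forall>i::2. P i) \<longleftrightarrow> P 0 \<and> P 1"
proof -
  have "(\<forall>i::2. P i) \<longleftrightarrow> (\<forall>i\<in>{0, 1::2}. P i)"
    by (simp add: UNIV_two[symmetric])
  then show ?thesis by simp
qed

lemma extension_nth:
  "extension l \<theta> $ (0, 0) = of_real (sqrt l * cos \<theta>)"
  "extension l \<theta> $ (0, 1) = of_real (sqrt (1 - l) * sin \<theta>)"
  "extension l \<theta> $ (1, 0) = of_real (sqrt l * sin \<theta>)"
  "extension l \<theta> $ (1, 1) = of_real (- sqrt (1 - l) * cos \<theta>)"
  by (simp_all add: extension_def tensor_vec_def aux_def aux_perp_def ket_def axis_def two_neq
      scaleR_conv_of_real[where 'a = complex])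

lemma incoherent_diag_qubit:
  assumes "0 \<le> l" "l \<le> 1"
  shows "incoherent (diag_qubit l)"
proof -
  have eq: "braket v (diag_qubit l *v v) = of_real (l * (cmod (v $ 0))\<^sup>2 + (1 - l) * (cmod (v $ 1))\<^sup>2)"
    for v
    by (simp add: braket_def matrix_vector_mult_def diag_qubit_def sum_two two_neq
        complex_norm_square algebra_simps del: of_real_power)
  have "psd (diag_qubit l)"
    unfolding psd_def eq using assms by simp
  moreover have "trace (diag_qubit l) = 1"
    by (simp add: trace_def sum_two diag_qubit_def two_neq)
  ultimately show ?thesis
    by (simp add: incoherent_def state_def diag_qubit_def)
qed

lemma purification_extension:
  assumes "0 \<le> l" "l \<le> 1"
  shows "purification_on_AB (extension l \<theta>) (diag_qubit l)"
proof -
  have sq: "sqrt l * sqrt l = l" "sqrt (1 - l) * sqrt (1 - l) = 1 - l"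
    using assms by simp_all
  have gen: "a * cos \<theta> * (a * cos \<theta>) + a * sin \<theta> * (a * sin \<theta>) = a * a" for a
  proof -
    have "a * cos \<theta> * (a * cos \<theta>) + a * sin \<theta> * (a * sin \<theta>)
        = a * a * (cos \<theta> * cos \<theta> + sin \<theta> * sin \<theta>)"
      by (simp only: algebra_simps)
    then show ?thesis by (simp only: sin_cos_squared_add3 mult_1_right)
  qed
  have r: "sqrt l * cos \<theta> * (sqrt l * cos \<theta>) + sqrt l * sin \<theta> * (sqrt l * sin \<theta>) = l"
    "sqrt (1 - l) * sin \<theta> * (sqrt (1 - l) * sin \<theta>)
       + sqrt (1 - l) * cos \<theta> * (sqrt (1 - l) * cos \<theta>) = 1 - l"
    using gen[of "sqrt l"] gen[of "sqrt (1 - l)"] sq by linarith+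
  have n: "braket (extension l \<theta>) (extension l \<theta>) = 1"
  proof -
    have "braket (extension l \<theta>) (extension l \<theta>) = of_real
      (sqrt l * cos \<theta> * (sqrt l * cos \<theta>) + sqrt l * sin \<theta> * (sqrt l * sin \<theta>) +
       (sqrt (1 - l) * sin \<theta> * (sqrt (1 - l) * sin \<theta>)
         + sqrt (1 - l) * cos \<theta> * (sqrt (1 - l) * cos \<theta>)))"
      by (simp add: braket_def sum_two_two extension_nth)
    then show ?thesis unfolding r by simp
  qed
  have "ptrace_A (proj (extension l \<theta>)) = diag_qubit l"
    unfolding vec_eq_iff all_two
    using r[THEN arg_cong[where f = complex_of_real]]
    by (simp add: ptrace_A_def proj_def sum_two extension_nth diag_qubit_def two_neq)
  with n show ?thesis by (simp add: purification_on_AB_def)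
qed

lemma concurrence_eq:
  "concurrence x = 2 * cmod (x $ (0, 0) * x $ (1, 1) - x $ (0, 1) * x $ (1, 0))"
proof -
  have "braket x (tensor_mat pauli_y pauli_y *v (\<chi> p. cnj (x $ p)))
      = - 2 * cnj (x $ (0, 0) * x $ (1, 1) - x $ (0, 1) * x $ (1, 0))"
    by (simp add: braket_def tensor_mat_def matrix_vector_mult_def pauli_y_def sum_two_two
        two_neq algebra_simps)
  then show ?thesis
    unfolding concurrence_def by (simp only: norm_mult complex_mod_cnj) simp
qed

lemma concurrence_extension:
  assumes "0 \<le> l" "l \<le> 1"
  shows "concurrence (extension l \<theta>) = 2 * sqrt (l * (1 - l))"
proof -
  have cs: "cos \<theta> * cos \<theta> = 1 - sin \<theta> * sin \<theta>"
    using sin_cos_squared_add3[of \<theta>] by linarith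
  have "sqrt l * cos \<theta> * (- sqrt (1 - l) * cos \<theta>) - sqrt (1 - l) * sin \<theta> * (sqrt l * sin \<theta>)
      = - (sqrt l * sqrt (1 - l))"
    using cs by algebra
  then have "concurrence (extension l \<theta>) = 2 * \<bar>- (sqrt l * sqrt (1 - l))\<bar>"
    unfolding concurrence_eq extension_nth of_real_mult[symmetric] of_real_diff[symmetric] norm_of_real
    by (simp only:)
  then show ?thesis
    using assms by (simp add: real_sqrt_mult)
qed

end

theory Submission
  imports Defs
begin

text \<open>For \<open>\<mu> = 1 - \<lambda>\<close> the angles \<open>\<theta> = \<pi>/2\<close>, \<open>\<phi> = 0\<close> give the extensions identical \<open>A\<close>-marginals,
  while the extensions themselves are orthogonal. Hence they are admissible for every \<open>d > 0\<close> and
  discriminate without error, which no measurement on \<open>B\<close> achieves unless \<open>\<lambda> \<in> {0, 1}\<close>. The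
  concurrence \<open>2 \<surd>(\<lambda>(1 - \<lambda>))\<close> does not depend on the angles and is pushed below \<open>E\<close> by
  choosing \<open>\<lambda>\<close> small.\<close>

section \<open>The sesquilinear form \<open>braket\<close> and matrix columns\<close>

lemma braket_dagger: "braket u (X *v v) = braket (dagger X *v u) v"
proof -
  have "braket u (X *v v) = (\<Sum>i\<in>UNIV. \<Sum>j\<in>UNIV. cnj (u $ i) * X $ i $ j * v $ j)"
    by (simp add: braket_def matrix_vector_mult_def sum_distrib_left mult.assoc)
  also have "\<dots> = (\<Sum>j\<in>UNIV. \<Sum>i\<in>UNIV. cnj (u $ i) * X $ i $ j * v $ j)"
    by (rule sum.swap)
  also have "\<dots> = braket (dagger X *v u) v"
    by (simp add: braket_def matrix_vector_mult_def dagger_def sum_distrib_left mult_ac)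
  finally show ?thesis .
qed

lemma braket_self: "braket v v = of_real (\<Sum>i\<in>UNIV. (cmod (v $ i))\<^sup>2)"
  by (simp add: braket_def complex_norm_square mult.commute del: of_real_power)

lemma braket_self_nonneg: "0 \<le> Re (braket v v)"
  by (simp add: braket_self sum_nonneg)

lemma braket_self_eq_0_iff: "braket v v = 0 \<longleftrightarrow> v = 0"
  by (simp only: braket_self of_real_eq_0_iff)
    (simp add: sum_nonneg_eq_0_iff vec_eq_iff)

lemma cnj_braket: "cnj (braket u v) = braket v u"
  by (simp add: braket_def mult.commute)

lemma braket_add_left: "braket (u + v) w = braket u w + braket v w"
  and braket_add_right: "braket w (u + v) = braket w u + braket w v"
  and braket_scale_left: "braket (c *s u) w = cnj c * braket u w"
  and braket_scale_right: "braket w (c *s u) = c * braket w u"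
  and braket_diff_right: "braket w (u - v) = braket w u - braket w v"
  by (simp_all add: braket_def algebra_simps sum.distrib sum_distrib_left sum_subtractf)

lemma braket_axis_left: "braket (axis i 1) v = v $ i"
  by (simp add: braket_def axis_def if_distrib[of cnj] if_distrib[of "\<lambda>x. x * _"] cong: if_cong)

lemma matrix_vector_mult_axis: "((X :: complex^'n^'m) *v axis j 1) $ i = X $ i $ j"
  by (simp add: matrix_vector_mult_def axis_def if_distrib[of "\<lambda>x. _ * x"] cong: if_cong)

lemma matrix_eq_0_axis:
  assumes "\<And>i. (X :: complex^'n^'m) *v axis i 1 = 0"
  shows "X = 0"
  using assms matrix_vector_mult_axis[of X] by (simp add: vec_eq_iff)

section \<open>Positive semidefinite matrices and their square roots\<close>

text \<open>Polarization: the form is real at e_i + e_j and at e_i + i e_j, which fixes the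
  imaginary and the real parts of the off-diagonal entries respectively.\<close>

lemma psd_imp_hermitian:
  assumes "psd X" shows "dagger X = X"
proof -
  have re: "Im (braket v (X *v v)) = 0" for v
    using assms complex_is_Real_iff unfolding psd_def by blast
  have "cnj (X $ j $ i) = X $ i $ j" for i j
  proof -
    let ?i = "axis i (1::complex)" and ?j = "axis j (1::complex)"
    have form: "braket (?i + c *s ?j) (X *v (?i + c *s ?j))
        = X $ i $ i + c * X $ i $ j + cnj c * X $ j $ i + cnj c * c * X $ j $ j" for c
      by (simp add: matrix_vector_right_distrib vector_scalar_commute braket_add_left
          braket_add_right braket_scale_left braket_scale_right braket_axis_left
          matrix_vector_mult_axis algebra_simps)
    have d: "Im (X $ k $ k) = 0" for k
      using re[of "axis k 1"] by (simp add: braket_axis_left matrix_vector_mult_axis)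
    show ?thesis
      using re[of "?i + 1 *s ?j"] re[of "?i + \<i> *s ?j"] unfolding form
      by (simp add: d complex_eq_iff)
  qed
  then show ?thesis by (simp add: dagger_def vec_eq_iff)
qed

lemma hermitian_mult_self_eq_0:
  assumes "dagger X = X" and "X *v (X *v v) = 0"
  shows "X *v v = 0"
  using braket_dagger[of v X "X *v v"] assms by (simp add: braket_self_eq_0_iff braket_def[of _ 0])

lemma linear_coefficient_eq_0:
  fixes a b :: real
  assumes "0 \<le> b" and "\<And>t. 0 \<le> t * a + t\<^sup>2 * b"
  shows "a = 0"
proof -
  \<comment> \<open>The value at t = - a / (b + 1); the + 1 keeps the denominator positive when b =
    0.\<close>
  have "- a / (b + 1) * a + (- a / (b + 1))\<^sup>2 * b = - (a / (b + 1))\<^sup>2"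
    using assms(1) by (simp add: divide_simps power2_eq_square) (simp add: algebra_simps)
  then have "0 \<le> - (a / (b + 1))\<^sup>2"
    using assms(2)[of "- a / (b + 1)"] by linarith
  then show ?thesis using assms(1) by simp
qed

text \<open>Perturb v in the direction w = X v: the form at v + t w is 2 t <w,w> + t^2 <w,X w>. It
  is nonnegative for all real t, so its linear coefficient vanishes.\<close>

lemma psd_kernel:
  assumes X: "psd X" and 0: "braket v (X *v v) = 0"
  shows "X *v v = 0"
proof -
  let ?w = "X *v v"
  let ?a = "Re (braket ?w ?w)" and ?b = "Re (braket ?w (X *v ?w))"
  have wv: "braket v (X *v ?w) = braket ?w ?w"
    using psd_imp_hermitian[OF X] by (simp add: braket_dagger)
  have "0 \<le> t * (2 * ?a) + t\<^sup>2 * ?b" for t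
  proof -
    have "braket (v + of_real t *s ?w) (X *v (v + of_real t *s ?w))
        = of_real t * (2 * braket ?w ?w) + of_real (t\<^sup>2) * braket ?w (X *v ?w)"
      by (simp add: matrix_vector_right_distrib vector_scalar_commute braket_add_left
          braket_add_right braket_scale_left braket_scale_right 0 wv power2_eq_square algebra_simps)
    moreover have "0 \<le> Re (braket (v + of_real t *s ?w) (X *v (v + of_real t *s ?w)))"
      using X unfolding psd_def by blast
    ultimately show ?thesis
      by (simp del: of_real_power)
  qed
  moreover have "0 \<le> ?b" using X by (simp add: psd_def)
  ultimately have "2 * ?a = 0" by (rule linear_coefficient_eq_0[rotated])
  then have "braket ?w ?w = 0" by (simp add: braket_self)
  then show ?thesis by (simp only: braket_self_eq_0_iff)
qed

text \<open>Moving the left factor D across the form turns the trace into values of the form of S at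
  the columns of D, which are nonnegative for psd S.\<close>

lemma trace_hermitian_sandwich:
  assumes "dagger D = D"
  shows "trace (D ** (S ** D)) = (\<Sum>i\<in>UNIV. braket (D *v axis i 1) (S *v (D *v axis i 1)))"
proof -
  have "braket (D *v axis i 1) (S *v (D *v axis i 1)) = (D ** (S ** D)) $ i $ i" for i
  proof -
    have "braket (D *v axis i 1) (S *v (D *v axis i 1))
        = braket (axis i 1) ((D ** (S ** D)) *v axis i 1)"
      using assms braket_dagger[of "axis i 1" D "S *v (D *v axis i 1)"]
      by (simp flip: matrix_vector_mul_assoc)
    then show ?thesis by (simp only: braket_axis_left matrix_vector_mult_axis)
  qed
  then show ?thesis by (simp add: trace_def)
qed

lemma dagger_diff: "dagger (X - Y) = dagger X - dagger Y"
  by (simp add: dagger_def vec_eq_iff)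

text \<open>With \<open>D = S - T\<close>, the equation \<open>S\<^sup>2 = T\<^sup>2\<close> reads \<open>SD + DT = 0\<close>. Multiplying by \<open>D\<close> and
  taking traces gives \<open>tr (DSD) + tr (DTD) = 0\<close>, so \<open>SD = TD = 0\<close> and hence \<open>D\<^sup>2 = 0\<close>; no
  commutation or spectral theorem is needed.\<close>

lemma psd_sqrt_unique:
  assumes S: "psd S" and T: "psd T" and eq: "S ** S = T ** T"
  shows "S = T"
proof -
  define D where "D = S - T"
  have D: "dagger D = D"
    using S T by (simp add: D_def dagger_diff psd_imp_hermitian)
  have "S ** D + D ** T = 0"
  proof -
    have "(S ** D + D ** T) *v w = (S ** S) *v w - (T ** T) *v w" for w
      by (simp add: D_def algebra_simps flip: matrix_vector_mul_assoc)
    then show ?thesis by (simp add: matrix_eq eq)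
  qed
  then have "trace (D ** (S ** D)) + trace (D ** (D ** T)) = 0"
    by (simp add: matrix_add_ldistrib[symmetric] trace_add[symmetric])
      (simp add: trace_def matrix_matrix_mult_def)
  moreover have "trace (D ** (D ** T)) = trace (D ** (T ** D))"
    using trace_mul_sym[of D "D ** T"] by (simp add: matrix_mul_assoc)
  ultimately have sum0: "(\<Sum>i\<in>UNIV. braket (D *v axis i 1) (S *v (D *v axis i 1))
      + braket (D *v axis i 1) (T *v (D *v axis i 1))) = 0" (is "(\<Sum>i\<in>UNIV. ?f i) = 0")
    by (simp add: trace_hermitian_sandwich[OF D] sum.distrib)
  have nonneg: "0 \<le> Re (?f i)" for i
    using S T by (simp add: psd_def)
  have zero: "Re (?f i) = 0" for i
    using arg_cong[OF sum0, of Re] nonneg by (simp add: sum_nonneg_eq_0_iff del: plus_complex.simps)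
  have "D *v axis i 1 = 0" for i
  proof -
    let ?v = "D *v axis i 1"
    have re: "braket ?v (S *v ?v) \<in> \<real>" "braket ?v (T *v ?v) \<in> \<real>"
      "0 \<le> Re (braket ?v (S *v ?v))" "0 \<le> Re (braket ?v (T *v ?v))"
      using S T by (auto simp: psd_def)
    with zero[of i] have "braket ?v (S *v ?v) = 0" "braket ?v (T *v ?v) = 0"
      by (auto simp: complex_eq_iff complex_is_Real_iff)
    then have "D *v ?v = 0"
      using psd_kernel[OF S, of ?v] psd_kernel[OF T, of ?v]
      by (simp only: D_def matrix_vector_mult_diff_rdistrib) simp
    then show ?thesis by (rule hermitian_mult_self_eq_0[OF D])
  qed
  then show ?thesis using matrix_eq_0_axis[of D] by (simp add: D_def)
qed

text \<open>Uniqueness makes the \<open>THE\<close> in \<open>psd_sqrt\<close> computable: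
  exhibiting one root suffices.\<close>

lemma psd_sqrt_eqI:
  assumes "psd S" and "S ** S = X"
  shows "psd_sqrt X = S"
  unfolding psd_sqrt_def using assms psd_sqrt_unique by blast

section \<open>Explicit trace norms\<close>

lemma scaleR_matrix_vector_mult: "(r *\<^sub>R (X :: complex^'n^'m)) *v v = of_real r *s (X *v v)"
  by (simp add: vec_eq_iff matrix_vector_mult_def sum_distrib_left
      scaleR_conv_of_real[where 'a = complex] mult.assoc)

text \<open>The hypothesis says that \<open>X\<close> has eigenvalues in \<open>{- s, 0, s}\<close>, so \<open>\<bar>X\<bar> = X\<^sup>2 / s\<close>.
  For \<open>s = 0\<close> both sides are zero, by the convention \<open>x / 0 = 0\<close>.\<close>

lemma trace_norm_cubic:
  assumes X: "dagger X = X" and s: "0 \<le> s"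
    and cubic: "\<And>v. X *v (X *v (X *v v)) = of_real (s\<^sup>2) *s (X *v v)"
  shows "trace_norm X = Re (trace (X ** X)) / s"
proof -
  let ?S = "(1 / s) *\<^sub>R (X ** X)"
  have mv: "?S *v v = of_real (1 / s) *s (X *v (X *v v))" for v
    by (simp add: scaleR_matrix_vector_mult matrix_vector_mul_assoc)
  have "psd ?S"
  proof -
    have "braket v (?S *v v) = of_real (1 / s) * braket (X *v v) (X *v v)" for v
      using braket_dagger[of v X "X *v v"] X by (simp only: mv braket_scale_right)
    then show ?thesis
      using s by (auto simp: psd_def braket_self sum_nonneg)
  qed
  moreover have "?S ** ?S = X ** X"
  proof -
    have "?S *v (?S *v v) = X *v (X *v v)" for v
    proof (cases "s = 0")
      \<comment> \<open>Now \<open>?S\<close> is zero, so X^2 has to vanish; X^3 = 0 and hermiticity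
        give this.\<close>
      case True
      then have "X *v (X *v (X *v v)) = 0" using cubic by simp
      then have "X *v (X *v v) = 0" by (rule hermitian_mult_self_eq_0[OF X])
      then show ?thesis by (simp add: mv)
    next
      case False
      then show ?thesis
        by (simp only: mv vector_scalar_commute cubic)
          (simp add: vec_eq_iff power2_eq_square)
    qed
    then show ?thesis by (simp add: matrix_eq flip: matrix_vector_mul_assoc)
  qed
  ultimately have "psd_sqrt (X ** X) = ?S" by (rule psd_sqrt_eqI)
  then show ?thesis
    by (simp add: trace_norm_def X trace_def sum_divide_distrib)
qed

lemma trace_norm_0: "trace_norm 0 = 0"
  by (subst trace_norm_cubic[where s = 0]) (auto simp: dagger_def vec_eq_iff)

lemma proj_mult_vec: "proj x *v v = braket x v *s x"
  by (simp add: vec_eq_iff proj_def matrix_vector_mult_def braket_def sum_distrib_left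
      sum_distrib_right mult_ac)

text \<open>With c = <x,y> and s^2 = 1 - |c|^2, the difference X satisfies X^3 = s^2 X and tr X^2 =
  2 s^2, so \<open>trace_norm_cubic\<close> applies, also for parallel vectors.\<close>

lemma trace_norm_proj_diff:
  fixes x y :: "complex^'n"
  assumes x: "braket x x = 1" and y: "braket y y = 1"
  shows "trace_norm (proj x - proj y) = 2 * sqrt (1 - (cmod (braket x y))\<^sup>2)"
proof -
  let ?X = "proj x - proj y" and ?c = "braket x y"
  let ?s = "sqrt (1 - (cmod ?c)\<^sup>2)"
  have mv: "?X *v v = braket x v *s x - braket y v *s y" for v
    by (simp add: matrix_vector_mult_diff_rdistrib proj_mult_vec)
  have yx: "braket y x = cnj ?c" by (simp add: cnj_braket)
  have herm: "dagger ?X = ?X"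
    by (simp add: dagger_def proj_def vec_eq_iff mult.commute)
  have "trace (?X ** ?X) = (\<Sum>i\<in>UNIV. (?X *v (?X *v axis i 1)) $ i)"
    by (simp only: trace_def matrix_vector_mul_assoc matrix_vector_mult_axis)
  also have "\<dots> = (\<Sum>i\<in>UNIV. cnj (x $ i) * x $ i + cnj (y $ i) * y $ i
      - cnj ?c * (cnj (x $ i) * y $ i) - ?c * (cnj (y $ i) * x $ i))"
  proof (rule sum.cong)
    fix i :: 'n
    have "braket v (axis i 1) = cnj (v $ i)" for v
      using cnj_braket[of "axis i 1" v] by (simp add: braket_axis_left)
    then show "(?X *v (?X *v axis i 1)) $ i = cnj (x $ i) * x $ i + cnj (y $ i) * y $ i
      - cnj ?c * (cnj (x $ i) * y $ i) - ?c * (cnj (y $ i) * x $ i)"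
      by (simp add: mv braket_diff_right braket_scale_right x y yx)
  qed simp
  also have "\<dots> = braket x x + braket y y - cnj ?c * ?c - ?c * braket y x"
    by (simp only: braket_def sum.distrib sum_subtractf sum_distrib_left)
  also have "\<dots> = of_real (2 * (1 - (cmod ?c)\<^sup>2))"
    by (simp add: x y yx complex_norm_square mult.commute del: of_real_power)
  finally have tr: "trace (?X ** ?X) = of_real (2 * (1 - (cmod ?c)\<^sup>2))" .
  \<comment> \<open>Cauchy-Schwarz for x and y, read off from tr X^2 being nonnegative.\<close>
  have "0 \<le> Re (trace (?X ** (mat 1 ** ?X)))"
    by (simp only: trace_hermitian_sandwich[OF herm] matrix_vector_mul_lid Re_sum)
      (simp only: braket_self_nonneg sum_nonneg)
  then have s: "0 \<le> 1 - (cmod ?c)\<^sup>2"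
    by (simp only: matrix_mul_lid tr Re_complex_of_real) simp
  have sc: "of_real (?s\<^sup>2) = 1 - ?c * cnj ?c"
    using s by (simp add: complex_norm_square del: of_real_power)
  have "?X *v (?X *v (?X *v v)) = of_real (?s\<^sup>2) *s (?X *v v)" for v
    unfolding sc by (simp add: mv braket_diff_right braket_scale_right x y yx vec_eq_iff)
      (simp add: algebra_simps)
  then have "trace_norm ?X = Re (trace (?X ** ?X)) / ?s"
    using s by (intro trace_norm_cubic herm) simp_all
  also have "\<dots> = 2 * ((1 - (cmod ?c)\<^sup>2) / ?s)"
    by (simp only: tr Re_complex_of_real)
  finally show ?thesis using s by (simp only: real_div_sqrt)
qed

text \<open>The difference is (l - m) diag(1, -1), whose square is scalar.\<close>

lemma trace_norm_diag_qubit_diff: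
  "trace_norm (diag_qubit l - diag_qubit m) = 2 * \<bar>l - m\<bar>"
proof -
  let ?X = "diag_qubit l - diag_qubit m"
  have mv: "(?X *v v) $ 0 = of_real (l - m) * v $ 0" "(?X *v v) $ 1 = - of_real (l - m) * v $ 1" for v
    by (simp_all add: matrix_vector_mult_def sum_two diag_qubit_def algebra_simps)
  have sq: "x\<^sup>2 / \<bar>x\<bar> = \<bar>x\<bar>" for x :: real
    by (simp add: abs_if power2_eq_square)
  have "trace_norm ?X = Re (trace (?X ** ?X)) / \<bar>l - m\<bar>"
  proof (rule trace_norm_cubic)
    show "dagger ?X = ?X"
      by (simp add: dagger_def diag_qubit_def vec_eq_iff)
    show "?X *v (?X *v (?X *v v)) = of_real (\<bar>l - m\<bar>\<^sup>2) *s (?X *v v)" for v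
      by (simp add: vec_eq_iff all_two mv power2_eq_square)
        (simp add: algebra_simps)
  qed simp
  also have "trace (?X ** ?X) = of_real (2 * (l - m)\<^sup>2)"
    by (simp add: trace_def matrix_matrix_mult_def sum_two diag_qubit_def power2_eq_square algebra_simps)
  also have "Re (of_real (2 * (l - m)\<^sup>2)) / \<bar>l - m\<bar> = 2 * \<bar>l - m\<bar>"
    using sq[of "l - m"] by (simp only: Re_complex_of_real times_divide_eq_right[symmetric])
  finally show ?thesis .
qed

section \<open>Entanglement and error-free discrimination\<close>

text \<open>A product vector would have a B-marginal of rank at most one, but l and 1 - l are both
  nonzero.\<close>

lemma purification_diag_qubit_entangled:
  assumes x: "purification_on_AB x (diag_qubit l)" and l: "0 < l" "l < 1"
  shows "entangled x"
  unfolding entangled_def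
proof
  assume "\<exists>u v. x = tensor_vec u v"
  then obtain u v where uv: "x = tensor_vec u v" by blast
  let ?n = "u $ 0 * cnj (u $ 0) + u $ 1 * cnj (u $ 1)"
  have entry: "diag_qubit l $ i $ j = ?n * (v $ i * cnj (v $ j))" for i j
  proof -
    have "diag_qubit l = ptrace_A (proj x)" using x by (simp add: purification_on_AB_def)
    then show ?thesis
      by (simp add: ptrace_A_def proj_def uv tensor_vec_def sum_two algebra_simps)
  qed
  have "of_real l * of_real (1 - l) = (0 :: complex)"
    using entry[of 0 0] entry[of 1 1] entry[of 0 1] by (auto simp: diag_qubit_def)
  then show False using l by (simp flip: of_real_mult of_real_diff)
qed

lemma npovm_error_orthogonal:
  assumes l: "0 \<le> l" "l \<le> 1" and "0 \<le> d" and E: "2 * sqrt (l * (1 - l)) \<le> E"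
  shows "0 \<in> npovm_errors l (1 - l) d E" and "npovm_error l (1 - l) d E = 0"
proof -
  have norm: "braket (extension k \<theta>) (extension k \<theta>) = 1" if "0 \<le> k" "k \<le> 1" for k \<theta>
    using purification_extension[OF that, of \<theta>] by (simp add: purification_on_AB_def)
  note tn = trace_norm_proj_diff[OF norm norm]
  \<comment> \<open>The vectors are sqrt(1-l) |01> + sqrt(l) |10> and sqrt(1-l) |00> - sqrt(l) |11>:
    disjoint supports, and both A-marginals are diag(1-l, l).\<close>
  have "ptrace_B (proj (extension l (pi / 2))) = ptrace_B (proj (extension (1 - l) 0))"
    by (simp add: vec_eq_iff all_two ptrace_B_def proj_def sum_two extension_nth)
  then have "(pi / 2, 0) \<in> npovm_feasible l (1 - l) d E"
    using assms by (simp add: npovm_feasible_def concurrence_extension trace_norm_0 mult.commute)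
  moreover have "braket (extension l (pi / 2)) (extension (1 - l) 0) = 0"
    by (simp add: braket_def sum_two_two extension_nth)
  then have "1/2 - 1/4 * trace_norm (proj (extension l (pi / 2)) - proj (extension (1 - l) 0)) = 0"
    using l by (simp add: tn)
  ultimately show mem: "0 \<in> npovm_errors l (1 - l) d E"
    unfolding npovm_errors_def by force
  \<comment> \<open>The trace norm of a difference of pure states is at most 2, so no error is
    negative and the value 0 is the minimum.\<close>
  have "0 \<le> e" if "e \<in> npovm_errors l (1 - l) d E" for e
    using that l by (auto simp: npovm_errors_def tn)
  with mem show "npovm_error l (1 - l) d E = 0"
    unfolding npovm_error_def by (intro cInf_eq_minimum)
qed

text \<open>The pair is chosen before d, so it serves all small d at once. Membership in
  \<open>npovm_errors\<close> certifies that the \<open>Inf\<close> is an attained minimum.\<close>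

theorem theorem3:
  fixes E :: real
  assumes "0 < E"
  shows "\<exists>l m :: real. 0 < l \<and> l < 1 \<and> 0 < m \<and> m < 1 \<and> diag_qubit l \<noteq> diag_qubit m \<and>
    incoherent (diag_qubit l) \<and> incoherent (diag_qubit m) \<and>
    (\<forall>x. purification_on_AB x (diag_qubit l) \<or> purification_on_AB x (diag_qubit m) \<longrightarrow> entangled x) \<and>
    (\<forall>d. 0 < d \<and> d < 1 \<longrightarrow>
       npovm_error l m d E \<in> npovm_errors l m d E \<and>
       npovm_error l m d E < povm_error (diag_qubit l) (diag_qubit m))"
proof -
  \<comment> \<open>The bound 1/4 keeps l different from 1 - l; the bound E^2 / 4 gives 4 l (1 - l)
    <= E^2.\<close>
  define l where "l = min (1/4) (E\<^sup>2 / 4)"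
  have l: "0 < l" "l < 1/2" "4 * l \<le> E\<^sup>2"
    using assms by (auto simp: l_def)
  have "2 * sqrt (l * (1 - l)) = sqrt (4 * (l * (1 - l)))"
    by (simp add: real_sqrt_mult)
  also have "\<dots> \<le> sqrt (E\<^sup>2)"
  proof (rule real_sqrt_le_mono)
    have "l * (1 - l) \<le> l * 1" using l by (intro mult_left_mono) auto
    then show "4 * (l * (1 - l)) \<le> E\<^sup>2" using l by linarith
  qed
  finally have E: "2 * sqrt (l * (1 - l)) \<le> E" using assms by simp
  \<comment> \<open>The trace norm is 2 (1 - 2 l), leaving the positive error l against 0.\<close>
  have "povm_error (diag_qubit l) (diag_qubit (1 - l)) = l"
    using l by (simp add: povm_error_def trace_norm_diag_qubit_diff field_simps)
  moreover have "diag_qubit l $ 0 $ 0 \<noteq> diag_qubit (1 - l) $ 0 $ 0"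
    using l by (simp add: diag_qubit_def del: of_real_diff)
  then have "diag_qubit l \<noteq> diag_qubit (1 - l)" by metis
  ultimately show ?thesis
    using l E npovm_error_orthogonal[of l _ E]
    by (intro exI[of _ l] exI[of _ "1 - l"])
      (auto simp: incoherent_diag_qubit intro: purification_diag_qubit_entangled)
qed

end
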